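(* Let $0<f<1$ and $R>0$. Suppose a large rollup with arrival rate $R$ and a small rollup with arrival rate $Rf$ both post blobs in an equilibrium with blob price $B$, and let $B^N$ be the blob price in an equilibrium after these two rollups join in posting blobs. Let $B_1$ be the Nash bargaining payment of the large rollup towards the joint blob, and let $B_1^{pr}=\frac{B^N}{1+f}$ be its proportional payment. Then $$B_1\le B_1^{pr}.$$
   Context: Fixed parameters: $a,G,P_1>0$ and a target $k>0$ of blobs per time unit; metadata costs are zero ($P_0=0$). At blob price $B$, a rollup with transaction arrival rate $R>0$ has optimal cost per transaction $\sqrt{2Ba/R}$ when posting blobs (posting every $\sqrt{2B/(aR)}$ time units) and $P_1G$ when posting directly on the L1 main market. Each rollup uses the cheaper strategy (either one in case of a tie). An equilibrium for a finite family of rollups with rates $(R_l)_{l\in I}$, $R_l>0$, is a pair $(B,S)$ with blob price $B>0$ and set $\emptyset\ne S\subseteq I$ of blob-posting rollups such that $B=\frac{a}{2k^2}\bigl(\sum_{l\in S}\sqrt{R_l}\bigr)^2$ (the target of $k$ blobs per time unit is met), $\sqrt{2Ba/R_l}\le P_1G$ for $l\in S$, and $\sqrt{2Ba/R_l}\ge P_1G$ for $l\in I\setminus S$. When two rollups join in posting blobs they are replaced by a single rollup whose rate is the sum of their rates; an equilibrium after joining is an equilibrium $(B^N,S^N)$ of the new family in which the joint rollup belongs to $S^N$. There may be any finite number of other rollups. Cost sharing. Posting alone at price $B$, the per-transaction costs are $Tr_L=\sqrt{2Ba/R}$ (large) and $Tr_S=\sqrt{2Ba/(Rf)}$ (small).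 A joint blob is posted every $t_J=\sqrt{\frac{2B^N}{(1+f)aR}}$ time units and contains $C_J=\sqrt{2B^NR(1+f)/a}$ transactions, of which $C_{J,L}=\frac{C_J}{1+f}$ are from the large and $C_{J,S}=\frac{fC_J}{1+f}$ from the small rollup. The total delay costs per joint blob are $d_{J,L}=\frac{aRt_J^2}{2}$ and $d_{J,S}=\frac{aRft_J^2}{2}$. If the large rollup pays $B_1$ and the small rollup pays $B^N-B_1$ of the joint blob price, the Nash bargaining payment $B_1$ is the maximizer over $B_1$ of the (rescaled) Nash product $$(B_1+d_{J,L}-C_{J,L}Tr_L)(B^N-B_1+d_{J,S}-C_{J,S}Tr_S),$$ that is, $B_1=\tfrac12\bigl(B^N+d_{J,S}-d_{J,L}-C_{J,S}Tr_S+C_{J,L}Tr_L\bigr)$. *)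

theory Defs
  imports Complex_Main
begin

text \<open>A rollup posts on the L1 main market at cost \<open>P1 * G\<close> per transaction (zero metadata costs);
  \<open>blob_cost a B R\<close> is its optimal cost per transaction when it posts blobs at price \<open>B\<close>.\<close>

definition blob_cost :: "real \<Rightarrow> real \<Rightarrow> real \<Rightarrow> real" where
  "blob_cost a B R = sqrt (2 * B * a / R)"

text \<open>\<open>equilibrium a G P1 k I r B S\<close>: the family of rollups is \<open>(r i)\<close> for \<open>i \<in> I\<close>.  A rollup
  that is indifferent may be in \<open>S\<close> or not.\<close>

definition equilibrium ::
    "real \<Rightarrow> real \<Rightarrow> real \<Rightarrow> real \<Rightarrow> 'i set \<Rightarrow> ('i \<Rightarrow> real) \<Rightarrow> real \<Rightarrow> 'i set \<Rightarrow> bool" where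
  "equilibrium a G P1 k I r B S \<longleftrightarrow>
     B > 0 \<and> S \<noteq> {} \<and> S \<subseteq> I \<and>
     B = a / (2 * k\<^sup>2) * (\<Sum>i\<in>S. sqrt (r i))\<^sup>2 \<and>
     (\<forall>i\<in>S. blob_cost a B (r i) \<le> P1 * G) \<and>
     (\<forall>i\<in>I - S. blob_cost a B (r i) \<ge> P1 * G)"

text \<open>When rollups \<open>i\<close> and \<open>j\<close> join, the joint rollup takes over the index \<open>i\<close>, and the index \<open>j\<close>
  is removed.\<close>

definition equilibrium_after_joining ::
    "real \<Rightarrow> real \<Rightarrow> real \<Rightarrow> real \<Rightarrow> 'i set \<Rightarrow> ('i \<Rightarrow> real) \<Rightarrow> 'i \<Rightarrow> 'i \<Rightarrow> real \<Rightarrow> 'i set \<Rightarrow> bool" where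
  "equilibrium_after_joining a G P1 k I r i j BN SN \<longleftrightarrow>
     equilibrium a G P1 k (I - {j}) (r(i := r i + r j)) BN SN \<and> i \<in> SN"

text \<open>Cost sharing between a large rollup of rate \<open>R\<close> and a small one of rate \<open>R * f\<close>.  The price
  \<open>B\<close> (before joining) determines the disagreement costs, the price \<open>BN\<close> (after joining) everything
  about the joint blob.\<close>

definition joint_interval :: "real \<Rightarrow> real \<Rightarrow> real \<Rightarrow> real \<Rightarrow> real" where
  "joint_interval a R f BN = sqrt (2 * BN / ((1 + f) * a * R))"

definition joint_size :: "real \<Rightarrow> real \<Rightarrow> real \<Rightarrow> real \<Rightarrow> real" where
  "joint_size a R f BN = sqrt (2 * BN * R * (1 + f) / a)"

definition joint_size_large :: "real \<Rightarrow> real \<Rightarrow> real \<Rightarrow> real \<Rightarrow> real" where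
  "joint_size_large a R f BN = joint_size a R f BN / (1 + f)"

definition joint_size_small :: "real \<Rightarrow> real \<Rightarrow> real \<Rightarrow> real \<Rightarrow> real" where
  "joint_size_small a R f BN = f * joint_size a R f BN / (1 + f)"

definition joint_delay_large :: "real \<Rightarrow> real \<Rightarrow> real \<Rightarrow> real \<Rightarrow> real" where
  "joint_delay_large a R f BN = a * R * (joint_interval a R f BN)\<^sup>2 / 2"

definition joint_delay_small :: "real \<Rightarrow> real \<Rightarrow> real \<Rightarrow> real \<Rightarrow> real" where
  "joint_delay_small a R f BN = a * R * f * (joint_interval a R f BN)\<^sup>2 / 2"

definition nash_product :: "real \<Rightarrow> real \<Rightarrow> real \<Rightarrow> real \<Rightarrow> real \<Rightarrow> real \<Rightarrow> real" where
  "nash_product a R f B BN B1 =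
     (B1 + joint_delay_large a R f BN - joint_size_large a R f BN * blob_cost a B R) *
     (BN - B1 + joint_delay_small a R f BN - joint_size_small a R f BN * blob_cost a B (R * f))"

definition nash_payment :: "real \<Rightarrow> real \<Rightarrow> real \<Rightarrow> real \<Rightarrow> real \<Rightarrow> real" where
  "nash_payment a R f B BN = arg_max (nash_product a R f B BN) (\<lambda>_. True)"

definition proportional_payment :: "real \<Rightarrow> real \<Rightarrow> real" where
  "proportional_payment f BN = BN / (1 + f)"

text \<open>The maximizer exists and is unique, so the choice made by \<^const>\<open>arg_max\<close> is determined.\<close>

lemma is_arg_max_quadratic:
  fixes p q x :: real
  shows "is_arg_max (\<lambda>x. (x + p) * (q - x)) (\<lambda>_. True) x \<longleftrightarrow> x = (q - p) / 2"
proof -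
  define m where "m = (q - p) / 2"
  have eq: "(y + p) * (q - y) = ((q + p) / 2)\<^sup>2 - (y - m)\<^sup>2" for y
    by (simp add: m_def power2_eq_square field_simps)
  have "is_arg_max (\<lambda>x. (x + p) * (q - x)) (\<lambda>_. True) x \<longleftrightarrow> (\<forall>y. (x - m)\<^sup>2 \<le> (y - m)\<^sup>2)"
    by (simp add: is_arg_max_def eq not_less)
  also have "\<dots> \<longleftrightarrow> x = m"
  proof
    assume "\<forall>y. (x - m)\<^sup>2 \<le> (y - m)\<^sup>2"
    then have "(x - m)\<^sup>2 \<le> (m - m)\<^sup>2" by blast
    then show "x = m" by simp
  qed simp
  finally show ?thesis by (simp add: m_def)
qed

lemma is_arg_max_nash_product:
  "is_arg_max (nash_product a R f B BN) (\<lambda>_. True) B1 \<longleftrightarrow>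
     B1 = (BN + joint_delay_small a R f BN - joint_delay_large a R f BN
             - joint_size_small a R f BN * blob_cost a B (R * f)
             + joint_size_large a R f BN * blob_cost a B R) / 2"
proof -
  define p where "p = joint_delay_large a R f BN - joint_size_large a R f BN * blob_cost a B R"
  define q where
    "q = BN + joint_delay_small a R f BN - joint_size_small a R f BN * blob_cost a B (R * f)"
  have "nash_product a R f B BN = (\<lambda>x. (x + p) * (q - x))"
    by (rule ext) (simp add: nash_product_def p_def q_def algebra_simps)
  then have "is_arg_max (nash_product a R f B BN) (\<lambda>_. True) B1 \<longleftrightarrow> B1 = (q - p) / 2"
    by (simp only: is_arg_max_quadratic)
  then show ?thesis
    by (simp add: p_def q_def algebra_simps)
qed

lemma nash_payment_eq:
  "nash_payment a R f B BN =
     (BN + joint_delay_small a R f BN - joint_delay_large a R f BN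
        - joint_size_small a R f BN * blob_cost a B (R * f)
        + joint_size_large a R f BN * blob_cost a B R) / 2"
  by (simp only: nash_payment_def arg_max_def is_arg_max_nash_product some_eq_trivial)

end

theory Submission imports Defs begin

text \<open>Write \<open>w = \<surd>f\<close>.  Substituting the joint blob's interval and size, the payment of the large
  rollup is \<open>f BN / (1 + f) + \<surd>(BN B) (1 - w) / \<surd>(1 + f)\<close>, so since \<open>1 - f = (1 - w) (1 + w)\<close> the
  claim amounts to \<open>\<surd>B \<surd>(1 + f) \<le> \<surd>BN (1 + w)\<close>: joining may lower the square root of the price at
  most by the factor \<open>\<surd>(1 + f) / (1 + w) \<le> 1\<close>.  If the price falls, every other rollup that posted
  blobs now strictly prefers blobs and stays.  The sum of the \<open>\<surd>r\<close> over the posting rollups,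
  which is proportional to the square root of the price, then loses at most the difference between
  \<open>\<surd>R (1 + w)\<close> and \<open>\<surd>R \<surd>(1 + f)\<close>, and the unchanged summands only help.\<close>

lemma sqrt_one_plus_le:
  fixes f :: real
  assumes "0 \<le> f"
  shows "sqrt (1 + f) \<le> 1 + sqrt f"
  using sqrt_add_le_add_sqrt[of 1 f] assms by simp

lemma nash_payment_closed_form:
  assumes "a > 0" "0 < f" "R > 0" "B > 0" "BN > 0"
  shows "nash_payment a R f B BN =
    f * BN / (1 + f) + sqrt BN * sqrt B * (1 - sqrt f) / sqrt (1 + f)"
proof -
  have t: "(joint_interval a R f BN)\<^sup>2 = 2 * (BN / (1 + f)) / (a * R)"
    unfolding joint_interval_def using assms by (subst real_sqrt_pow2) (auto simp: mult.assoc)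
  have dL: "joint_delay_large a R f BN = BN / (1 + f)"
    using assms unfolding joint_delay_large_def t by (simp del: distrib_left_numeral distrib_right_numeral)
  have dS: "joint_delay_small a R f BN = f * BN / (1 + f)"
    using assms unfolding joint_delay_small_def t by (simp del: distrib_left_numeral distrib_right_numeral)
  have n: "sqrt (1 + f) * sqrt (1 + f) = 1 + f"
    using assms by simp
  \<comment> \<open>The rate \<open>R\<close> and the delay parameter \<open>a\<close> cancel in
    this product, so only the two prices and \<open>f\<close> remain.\<close>
  have "joint_size a R f BN * blob_cost a B R = sqrt (2\<^sup>2 * (BN * B * (1 + f)))"
    unfolding joint_size_def blob_cost_def real_sqrt_mult[symmetric]
    using assms by (simp add: field_simps)
  then have L: "joint_size a R f BN * blob_cost a B R = 2 * (sqrt BN * sqrt B * sqrt (1 + f))"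
    by (simp add: real_sqrt_mult)
  have S: "blob_cost a B (R * f) = blob_cost a B R / sqrt f"
    by (simp add: blob_cost_def real_sqrt_divide real_sqrt_mult)
  have cL: "joint_size_large a R f BN * blob_cost a B R = 2 * (sqrt BN * sqrt B) / sqrt (1 + f)"
  proof -
    have "joint_size_large a R f BN * blob_cost a B R = 2 * (sqrt BN * sqrt B * sqrt (1 + f)) / (1 + f)"
      by (simp add: joint_size_large_def flip: L)
    also have "\<dots> = 2 * (sqrt BN * sqrt B) / sqrt (1 + f)"
      using assms n by (simp add: divide_simps)
    finally show ?thesis .
  qed
  \<comment> \<open>The small rollup supplies \<open>f\<close> times as many transactions, each
    \<open>1 / sqrt f\<close> times as costly when it posts alone.\<close>
  have "joint_size_small a R f BN * blob_cost a B (R * f) =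
      f / sqrt f * (joint_size_large a R f BN * blob_cost a B R)"
    by (simp add: joint_size_small_def joint_size_large_def S mult_ac)
  also have "f / sqrt f = sqrt f"
    using assms by (simp add: real_div_sqrt)
  finally have cS: "joint_size_small a R f BN * blob_cost a B (R * f) =
      sqrt f * (2 * (sqrt BN * sqrt B) / sqrt (1 + f))"
    by (simp only: cL)
  \<comment> \<open>At the optimal interval the total delay cost of a joint blob equals its
    price.\<close>
  have "BN / (1 + f) + f * BN / (1 + f) = (1 + f) * BN / (1 + f)"
    by (simp only: add_divide_distrib[symmetric] distrib_right mult_1)
  also have "\<dots> = BN"
    using assms by simp
  finally have shares: "BN / (1 + f) + f * BN / (1 + f) = BN" .
  have "BN + f * BN / (1 + f) - BN / (1 + f) = 2 * (f * BN / (1 + f))"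
  proof -
    have "z + y - x = 2 * y" if "x + y = z" for x y z :: real
      using that by simp
    from this[OF shares] show ?thesis .
  qed
  moreover have "(2 * p - w * (2 * q / s) + 2 * q / s) / 2 = p + q * (1 - w) / s" for p q s w :: real
    by (simp add: add_divide_distrib diff_divide_distrib right_diff_distrib mult_ac)
  ultimately show ?thesis
    unfolding nash_payment_eq dL dS cL cS by (simp only:)
qed

text \<open>Taking roots makes the price linear in the sum, so changes of price can be compared
  summand by summand. The sum is nonnegative, hence no absolute value remains.\<close>

lemma equilibrium_sqrt_price:
  assumes "equilibrium a G P1 k I r B S" "a > 0" "k > 0" "\<forall>i\<in>I. r i \<ge> 0"
  shows "sqrt B = sqrt (a / 2) / k * (\<Sum>i\<in>S. sqrt (r i))"
proof -
  have "(\<Sum>i\<in>S. sqrt (r i)) \<ge> 0"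
    using assms by (intro sum_nonneg) (auto simp: equilibrium_def)
  moreover
  have "B = a / 2 * ((\<Sum>i\<in>S. sqrt (r i)) / k)\<^sup>2"
    using assms by (simp add: equilibrium_def power_divide)
  then have "sqrt B = sqrt (a / 2) * sqrt (((\<Sum>i\<in>S. sqrt (r i)) / k)\<^sup>2)"
    by (simp only: real_sqrt_mult)
  ultimately show ?thesis
    using assms(3) by simp
qed

text \<open>A lower price and a higher rate both reduce the blob cost. The strict price drop makes
  the reduction strict, which excludes the tie that would let \<open>i\<close> stay outside
  \<open>S'\<close>. Allowing the rate to grow covers the joint rollup.\<close>

lemma equilibrium_stays_if_price_falls:
  assumes "equilibrium a G P1 k I r B S" "equilibrium a G P1 k I' r' B' S'"
    and "a > 0" "B' < B" "i \<in> S" "i \<in> I'" "r i > 0" "r i \<le> r' i"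
  shows "i \<in> S'"
proof (rule ccontr)
  assume "i \<notin> S'"
  then have "P1 * G \<le> blob_cost a B' (r' i)"
    using assms by (auto simp: equilibrium_def)
  moreover have "blob_cost a B (r i) \<le> P1 * G"
    using assms by (auto simp: equilibrium_def)
  moreover have "B' > 0"
    using assms(2) by (simp add: equilibrium_def)
  then have "2 * B' * a / r' i < 2 * B * a / r i"
    using assms(3,4,7,8) by (intro frac_less) simp_all
  then have "blob_cost a B' (r' i) < blob_cost a B (r i)"
    by (simp add: blob_cost_def)
  ultimately show False by simp
qed

lemma sqrt_price_after_joining:
  assumes "a > 0" "k > 0" "0 < f" "R > 0"
    and "finite I" and r: "\<forall>i\<in>I. r i > 0"
    and ij: "i \<noteq> j" "r i = R" "r j = R * f"
    and eq: "equilibrium a G P1 k I r B S" "i \<in> S" "j \<in> S"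
    and joined: "equilibrium_after_joining a G P1 k I r i j BN SN"
  shows "sqrt B * sqrt (1 + f) \<le> sqrt BN * (1 + sqrt f)"
proof (cases "B \<le> BN")
  case True
  then show ?thesis
    using assms(3) eq(1) by (intro mult_mono sqrt_one_plus_le) (auto simp: equilibrium_def)
next
  case False
  define r' where "r' = r(i := r i + r j)"
  define X where "X = (\<Sum>l\<in>S - {i, j}. sqrt (r l))"
  have eqN: "equilibrium a G P1 k (I - {j}) r' BN SN"
    using joined by (simp add: equilibrium_after_joining_def r'_def)
  have sub: "S \<subseteq> I" "SN \<subseteq> I"
    using eq(1) eqN by (auto simp: equilibrium_def)
  have fin: "finite S" "finite SN"
    using sub \<open>finite I\<close> by (auto intro: finite_subset)
  have r'_ge: "r l \<le> r' l" for l
    using ij assms(3,4) by (simp add: r'_def)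
  have r'_nonneg: "r' l \<ge> 0" if "l \<in> I" for l
    using r that r'_ge[of l] by force
  have stay: "S - {j} \<subseteq> SN"
    using equilibrium_stays_if_price_falls[OF eq(1) eqN] False sub r r'_ge assms(1) by force
  have "X \<ge> 0"
    unfolding X_def using r sub by (intro sum_nonneg) (auto intro: less_imp_le)
  have "S = insert i (insert j (S - {i, j}))"
    using eq by auto
  then have "(\<Sum>l\<in>S. sqrt (r l)) = (\<Sum>l\<in>insert i (insert j (S - {i, j})). sqrt (r l))"
    by (rule arg_cong)
  also have "\<dots> = sqrt R * (1 + sqrt f) + X"
    using fin ij by (simp add: X_def real_sqrt_mult algebra_simps)
  finally have sumS: "(\<Sum>l\<in>S. sqrt (r l)) = sqrt R * (1 + sqrt f) + X" .
  have "S - {j} = insert i (S - {i, j})"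
    using eq ij by auto
  then have "(\<Sum>l\<in>S - {j}. sqrt (r' l)) = (\<Sum>l\<in>insert i (S - {i, j}). sqrt (r' l))"
    by (rule arg_cong)
  also have "\<dots> = sqrt (R + R * f) + (\<Sum>l\<in>S - {i, j}. sqrt (r' l))"
    using fin ij by (simp add: r'_def)
  also have "(\<Sum>l\<in>S - {i, j}. sqrt (r' l)) = X"
    unfolding X_def r'_def by (intro sum.cong) auto
  also have "sqrt (R + R * f) = sqrt R * sqrt (1 + f)"
    using real_sqrt_mult[of R "1 + f"] by (simp add: distrib_left)
  finally have "sqrt R * sqrt (1 + f) + X = (\<Sum>l\<in>S - {j}. sqrt (r' l))" by simp
  \<comment> \<open>Rollups that newly switch to blobs can only enlarge the sum.\<close>
  also have "\<dots> \<le> (\<Sum>l\<in>SN. sqrt (r' l))"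
    using fin(2) stay
  proof (rule sum_mono2)
    show "0 \<le> sqrt (r' l)" if "l \<in> SN - (S - {j})" for l
      using that sub r'_nonneg by auto
  qed
  finally have sumSN: "sqrt R * sqrt (1 + f) + X \<le> (\<Sum>l\<in>SN. sqrt (r' l))" .
  \<comment> \<open>After cross-multiplication the terms of the joining pair agree exactly; only the
    \<open>X\<close> terms need \<open>sqrt (1 + f) \<le> 1 + sqrt f\<close>.\<close>
  have "(\<Sum>l\<in>S. sqrt (r l)) * sqrt (1 + f) = sqrt R * sqrt (1 + f) * (1 + sqrt f) + X * sqrt (1 + f)"
    by (simp add: sumS algebra_simps)
  also have "\<dots> \<le> sqrt R * sqrt (1 + f) * (1 + sqrt f) + X * (1 + sqrt f)"
    using \<open>X \<ge> 0\<close> assms(3) by (intro add_left_mono mult_left_mono sqrt_one_plus_le) auto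
  also have "\<dots> = (sqrt R * sqrt (1 + f) + X) * (1 + sqrt f)"
    by (simp add: algebra_simps)
  also have "\<dots> \<le> (\<Sum>l\<in>SN. sqrt (r' l)) * (1 + sqrt f)"
    using assms(3) by (intro mult_right_mono sumSN) simp
  finally have main: "(\<Sum>l\<in>S. sqrt (r l)) * sqrt (1 + f) \<le> (\<Sum>l\<in>SN. sqrt (r' l)) * (1 + sqrt f)" .
  have "sqrt B = sqrt (a / 2) / k * (\<Sum>l\<in>S. sqrt (r l))"
    using equilibrium_sqrt_price[OF eq(1)] assms(1,2) r by (simp add: less_imp_le)
  moreover have "sqrt BN = sqrt (a / 2) / k * (\<Sum>l\<in>SN. sqrt (r' l))"
    using equilibrium_sqrt_price[OF eqN] assms(1,2) r'_nonneg by simp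
  ultimately show ?thesis
    using mult_left_mono[OF main, of "sqrt (a / 2) / k"] assms(1,2) by (simp only: mult.assoc) simp
qed

theorem proposition6:
  fixes a G P1 k R f B BN :: real
    and I S SN :: "'i set" and r :: "'i \<Rightarrow> real" and large small :: 'i
  assumes "a > 0" and "G > 0" and "P1 > 0" and "k > 0"
    and "0 < f" and "f < 1" and "R > 0"
    and "finite I" and "\<forall>i\<in>I. r i > 0"
    and "large \<in> I" and "small \<in> I" and "large \<noteq> small"
    and "r large = R" and "r small = R * f"
    and "equilibrium a G P1 k I r B S" and "large \<in> S" and "small \<in> S"
    and "equilibrium_after_joining a G P1 k I r large small BN SN"
  shows "nash_payment a R f B BN \<le> proportional_payment f BN"
proof -
  have pos: "B > 0" "BN > 0"
    using assms(15,18) by (auto simp: equilibrium_def equilibrium_after_joining_def)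
  define s where "s = sqrt (1 + f)"
  have s: "s > 0" "s * s = 1 + f"
    using assms(5) by (simp_all add: s_def)
  have "sqrt B * s \<le> sqrt BN * (1 + sqrt f)"
    unfolding s_def
    by (rule sqrt_price_after_joining[OF assms(1,4,5,7,8,9,12-18)])
  \<comment> \<open>The factor is nonnegative because \<open>f < 1\<close>; it turns
    \<open>1 + sqrt f\<close> into \<open>1 - f\<close> on the right.\<close>
  then have "sqrt BN * (1 - sqrt f) * (sqrt B * s) \<le> sqrt BN * (1 - sqrt f) * (sqrt BN * (1 + sqrt f))"
    using assms(5,6) pos by (intro mult_left_mono) auto
  also have "\<dots> = (sqrt BN * sqrt BN) * (1 - sqrt f * sqrt f)"
    by (simp only: algebra_simps)
  also have "\<dots> = BN * (1 - f)"
    using assms(5) pos by simp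
  finally have "sqrt BN * sqrt B * (1 - sqrt f) * s / (s * s) \<le> BN * (1 - f) / (s * s)"
    using s(1) by (intro divide_right_mono) (auto simp: algebra_simps)
  then have "sqrt BN * sqrt B * (1 - sqrt f) / s \<le> BN * (1 - f) / (1 + f)"
    using s(1) by (simp flip: s(2))
  \<comment> \<open>This is the gap between the proportional payment and the first term of the
    closed form.\<close>
  moreover have "BN * (1 - f) / (1 + f) = BN / (1 + f) - f * BN / (1 + f)"
    by (simp add: algebra_simps diff_divide_distrib)
  ultimately show ?thesis
    using nash_payment_closed_form[OF assms(1,5,7) pos]
    unfolding proportional_payment_def s_def by linarith
qed

end
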